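(* For every integer $m\ge2$, with $E=\{0,1,\dots,m\}$, there exist a simplicial rational cone $K_m\subseteq\mathbb R_+^{E}$ for which $P_m=K_m\cap[0,1]^E$ is a simplex, and an objective $c$ that is a unit coordinate vector of $\mathbb R^E$, with $\max\{c^\top y:y\in P_m\}>0$, such that for every $\ell\ge1$, $$\mathcal B_\ell=\{J\subseteq E:0\in J\}\cup\{J\subseteq\{1,\dots,m\}:|J|\ge\ell+1\}.$$ Consequently, $\mathcal B_1\supsetneq\mathcal B_2\supsetneq\cdots\supsetneq\mathcal B_m=\mathcal B_\infty$. Thus the general bound $\mathcal B_\infty=\mathcal B_{|E|-1}$ on the stabilization level is best possible (here $|E|-1=m$), even when $P$ is a simplex.
   Context: A simplicial rational cone is a cone generated by finitely many linearly independent rational vectors. A polytope is a simplex if its vertices are affinely independent. For $y\in\mathbb R_+^E$, $\operatorname{supp}(y)=\{e\in E:y_e>0\}$. For a cone $K\subseteq\mathbb R_+^E$, $P=K\cap[0,1]^E$, and $c\in\mathbb R^E$ with $\alpha=\max\{c^\top y:y\in P\}>0$, and an integer $\ell\ge1$, $\mathcal B_\ell$ is the family of sets $J\subseteq E$ such that for all $z^1,\dots,z^\ell\in P$: $\left(\bigcap_{i=1}^\ell\operatorname{supp}(z^i)\right)\cap J=\emptyset$ implies $\sum_{i=1}^\ell c^\top z^i\le\alpha(\ell-1)$. $\mathcal B_\infty=\bigcap_{\ell\ge1}\mathcal B_\ell$. In general (for $|E|\ge 2$) one has $\mathcal B_\infty=\mathcal B_{|E|-1}$. *)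

theory Defs
  imports "HOL-Analysis.Analysis" "HOL-Analysis.Finite_Function_Topology"
begin

(* A vector of R^E is a finitely supported function whose nonzero coordinates lie in E.
   All vectors thus live in one real vector space, whatever the finite set E is, and the
   library notions of hulls, independence and extreme points apply to them. *)
type_synonym 'e rvec = "'e \<Rightarrow>\<^sub>0 real"

definition vecs :: "'e set \<Rightarrow> 'e rvec set"
  where "vecs E = {y. Poly_Mapping.keys y \<subseteq> E}"

definition rational_vecs :: "'e set \<Rightarrow> 'e rvec set"
  where "rational_vecs E = {y \<in> vecs E. \<forall>e\<in>E. Poly_Mapping.lookup y e \<in> \<rat>}"

definition nonneg_orthant :: "'e set \<Rightarrow> 'e rvec set"
  where "nonneg_orthant E = {y \<in> vecs E. \<forall>e\<in>E. 0 \<le> Poly_Mapping.lookup y e}"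

definition unit_cube :: "'e set \<Rightarrow> 'e rvec set"
  where "unit_cube E = {y \<in> vecs E. \<forall>e\<in>E. Poly_Mapping.lookup y e \<in> {0..1}}"

definition dot :: "'e set \<Rightarrow> 'e rvec \<Rightarrow> 'e rvec \<Rightarrow> real"
  where "dot E c y = (\<Sum>e\<in>E. Poly_Mapping.lookup c e * Poly_Mapping.lookup y e)"

definition supp :: "'e set \<Rightarrow> 'e rvec \<Rightarrow> 'e set"
  where "supp E y = {e \<in> E. Poly_Mapping.lookup y e > 0}"

definition simplicial_rational_cone :: "'e set \<Rightarrow> 'e rvec set \<Rightarrow> bool"
  where "simplicial_rational_cone E K \<longleftrightarrow>
    (\<exists>G. finite G \<and> G \<subseteq> rational_vecs E \<and> independent G \<and> K = convex_cone hull G)"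

(* The library predicate for simplices is restricted to type class euclidean_space. *)
definition is_simplex :: "'a::real_vector set \<Rightarrow> bool"
  where "is_simplex P \<longleftrightarrow> polytope P \<and> \<not> affine_dependent {v. v extreme_point_of P}"

definition is_max_on :: "('a \<Rightarrow> real) \<Rightarrow> 'a set \<Rightarrow> real \<Rightarrow> bool"
  where "is_max_on f S a \<longleftrightarrow> a \<in> f ` S \<and> (\<forall>y\<in>S. f y \<le> a)"

(* The family B_l; a is meant to be the maximum of c over P. Only l >= 1 is meaningful:
   for l = 0 the intersection below would be UNIV. *)
definition blocking ::
    "'e set \<Rightarrow> 'e rvec set \<Rightarrow> 'e rvec \<Rightarrow> real \<Rightarrow> nat \<Rightarrow> 'e set set"
  where "blocking E P c a l = {J. J \<subseteq> E \<and>
    (\<forall>z. (\<forall>i\<in>{1..l}. z i \<in> P) \<longrightarrow> (\<Inter>i\<in>{1..l}. supp E (z i)) \<inter> J = {} \<longrightarrow>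
      (\<Sum>i=1..l. dot E c (z i)) \<le> a * (real l - 1))}"

definition blocking_inf :: "'e set \<Rightarrow> 'e rvec set \<Rightarrow> 'e rvec \<Rightarrow> real \<Rightarrow> 'e set set"
  where "blocking_inf E P c a = (\<Inter>l\<in>{1..}. blocking E P c a l)"

end

theory Submission
  imports Defs
begin

text \<open>
  The cone is generated by the \<open>m\<close> vectors \<open>w\<^sub>i\<close> (\<open>1 \<le> i \<le> m\<close>) that are \<open>0\<close> at \<open>i\<close> and \<open>1\<close> at all
  other coordinates, and the objective is the coordinate \<open>y\<^sub>0\<close>. If \<open>y = \<Sum>\<^sub>i \<lambda>\<^sub>i w\<^sub>i\<close> with
  \<open>\<lambda> \<ge> 0\<close>, then \<open>y\<^sub>0 = \<Sum>\<^sub>i \<lambda>\<^sub>i\<close> and \<open>y\<^sub>j = y\<^sub>0 - \<lambda>\<^sub>j\<close> for \<open>j \<ge> 1\<close>. All coordinates are therefore at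
  most \<open>y\<^sub>0\<close>, so that the cube cuts the cone only through \<open>y\<^sub>0 \<le> 1\<close>; the result is the simplex with
  vertices \<open>0, w\<^sub>1, \<dots>, w\<^sub>m\<close>, on which \<open>y\<^sub>0\<close> has maximum \<open>1\<close>.

  One coordinate \<open>j \<ge> 1\<close> can be brought to \<open>0\<close> at no loss in the objective, by choosing \<open>w\<^sub>j\<close>. Two of
  them cannot: \<open>y\<^sub>0 \<le> y\<^sub>j + y\<^sub>k\<close> for \<open>j \<noteq> k\<close> on the whole cone, so a point that vanishes at both has
  objective \<open>0\<close>. Hence \<open>\<ell>\<close> points can jointly avoid \<open>\<ell>\<close> coordinates with total objective \<open>\<ell>\<close>. If
  they avoid \<open>\<ell> + 1\<close> coordinates, then by the pigeonhole principle one of them vanishes at two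
  coordinates, and the total is at most \<open>\<ell> - 1\<close>. The same bound holds when one of the points
  vanishes at \<open>0\<close>, whence the sets that contain \<open>0\<close>.
\<close>

section \<open>Truncated simplicial cones\<close>

text \<open>
  The functional \<open>f\<close> has value \<open>1\<close> on the convex hull of \<open>G\<close>, so a point \<open>r x\<close> of the cone, with \<open>x\<close>
  in this hull, has \<open>f (r x) = r\<close>. For \<open>r \<le> 1\<close> it lies on the segment from \<open>0\<close> to \<open>x\<close>.
\<close>

lemma truncated_convex_cone_hull:
  fixes f :: "'a::real_vector \<Rightarrow> real"
  assumes f: "linear f" and G: "\<And>g. g \<in> G \<Longrightarrow> f g = 1"
  shows "(convex_cone hull G) \<inter> {y. f y \<le> 1} = convex hull (insert 0 G)"
proof
  show "convex hull (insert 0 G) \<subseteq> (convex_cone hull G) \<inter> {y. f y \<le> 1}"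
  proof (rule hull_minimal)
    show "insert 0 G \<subseteq> (convex_cone hull G) \<inter> {y. f y \<le> 1}"
      using G by (auto simp: convex_cone_hull_contains_0 hull_inc linear_0[OF f])
    have "convex (f -` {..1})"
      using f by (rule convex_linear_vimage) simp
    moreover have "f -` {..1} = {y. f y \<le> 1}" by auto
    ultimately show "convex ((convex_cone hull G) \<inter> {y. f y \<le> 1})"
      by (simp add: convex_Int convex_convex_cone_hull)
  qed
  show "(convex_cone hull G) \<inter> {y. f y \<le> 1} \<subseteq> convex hull (insert 0 G)"
  proof clarify
    fix y assume y: "y \<in> convex_cone hull G" and le: "f y \<le> 1"
    show "y \<in> convex hull (insert 0 G)"
    proof (cases "y = 0")
      case True
      then show ?thesis by (simp add: hull_inc)
    next
      case False
      then have "y \<in> conic hull (convex hull G)"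
        using y by (simp add: convex_cone_hull_separate)
      then obtain r x where r: "0 \<le> r" and x: "x \<in> convex hull G" and yr: "y = r *\<^sub>R x"
        by (auto simp: conic_hull_explicit)
      have "convex (f -` {1})"
        using f by (rule convex_linear_vimage) simp
      then have "convex hull G \<subseteq> f -` {1}"
        using G by (intro hull_minimal) auto
      then have "r \<le> 1"
        using x le f by (auto simp: yr linear_cmul)
      moreover have "x \<in> convex hull (insert 0 G)"
        using x hull_mono[of G "insert 0 G" convex] by auto
      moreover have "0 \<in> convex hull (insert 0 G)"
        by (simp add: hull_inc)
      ultimately have "(1 - r) *\<^sub>R 0 + r *\<^sub>R x \<in> convex hull (insert 0 G)"
        using r by (intro convexD[OF convex_convex_hull]) auto
      then show ?thesis by (simp add: yr)
    qed
  qed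
qed

lemma is_simplex_convex_hull:
  assumes "finite S" "\<not> affine_dependent S"
  shows "is_simplex (convex hull S)"
proof -
  have "{v. v extreme_point_of (convex hull S)} \<subseteq> S"
    using extreme_point_of_convex_hull by auto
  then show ?thesis
    using assms affine_independent_subset by (auto simp: is_simplex_def polytope_def)
qed

lemma affine_independent_insert_0:
  assumes "independent G"
  shows "\<not> affine_dependent (insert 0 G)"
proof -
  have "0 \<notin> G" using assms dependent_zero by blast
  then show ?thesis using assms by (simp add: affine_dependent_iff_dependent)
qed

section \<open>The cone\<close>

lemma lookup_scaleR [simp]:
  "Poly_Mapping.lookup (r *\<^sub>R y) e = r *\<^sub>R Poly_Mapping.lookup y e"
proof -
  have "finite {i. r *\<^sub>R Poly_Mapping.lookup y i \<noteq> 0}"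
    by (rule finite_subset[OF _ finite_keys[of y]]) (auto simp: in_keys_iff)
  then show ?thesis by (simp add: scaleR_poly_mapping_def)
qed

definition all_but :: "nat \<Rightarrow> nat \<Rightarrow> nat rvec"
  where "all_but m i = (\<Sum>j\<in>{0..m} - {i}. Poly_Mapping.single j 1)"

definition all_but_cone :: "nat \<Rightarrow> nat rvec set"
  where "all_but_cone m = convex_cone hull (all_but m ` {1..m})"

lemma lookup_all_but:
  "Poly_Mapping.lookup (all_but m i) j = (if j \<le> m \<and> j \<noteq> i then 1 else 0)"
  by (auto simp: all_but_def lookup_sum lookup_single when_def)

lemma all_but_in_vecs: "all_but m i \<in> vecs {0..m}"
  by (auto simp: vecs_def in_keys_iff lookup_all_but split: if_splits)

lemma inj_on_all_but: "inj_on (all_but m) {1..m}"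
proof
  fix i j assume "i \<in> {1..m}" "j \<in> {1..m}" "all_but m i = all_but m j"
  then have "Poly_Mapping.lookup (all_but m i) i = Poly_Mapping.lookup (all_but m j) i" by simp
  then show "i = j" using \<open>i \<in> {1..m}\<close> by (auto simp: lookup_all_but split: if_splits)
qed

text \<open>
  In a vanishing linear combination, coordinate \<open>0\<close> gives that the coefficients have sum \<open>0\<close>, and
  coordinate \<open>j\<close> gives the same for the coefficients other than the \<open>j\<close>-th.
\<close>

lemma independent_all_but: "independent (all_but m ` {1..m})"
proof -
  have "u v = 0"
    if 0: "(\<Sum>v\<in>all_but m ` {1..m}. u v *\<^sub>R v) = 0" and v: "v \<in> all_but m ` {1..m}" for u v
  proof -
    obtain j where j: "j \<in> {1..m}" and vj: "v = all_but m j" using v by auto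
    have "(\<Sum>i\<in>{1..m}. u (all_but m i) *\<^sub>R all_but m i) = 0"
      using 0 unfolding sum.reindex[OF inj_on_all_but] by (simp only: o_def)
    then have *: "(\<Sum>i\<in>{1..m}. u (all_but m i) * Poly_Mapping.lookup (all_but m i) k) = 0" for k
      by (drule_tac arg_cong[where f = "\<lambda>y. Poly_Mapping.lookup y k"]) (simp add: lookup_sum)
    have "(\<Sum>i\<in>{1..m}. u (all_but m i)) = 0"
      using *[of 0] by (simp add: lookup_all_but)
    moreover have "(\<Sum>i\<in>{1..m} - {j}. u (all_but m i)) = 0"
    proof -
      have "(\<Sum>i\<in>{1..m}. u (all_but m i) * Poly_Mapping.lookup (all_but m i) j)
          = (\<Sum>i\<in>{1..m} - {j}. u (all_but m i))"
        using j by (intro sum.mono_neutral_cong_right) (auto simp: lookup_all_but)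
      then show ?thesis using *[of j] by simp
    qed
    ultimately show "u v = 0"
      using sum.remove[OF _ j, of "\<lambda>i. u (all_but m i)"] by (simp add: vj)
  qed
  then show ?thesis by (auto simp: dependent_finite)
qed

lemma simplicial_all_but_cone: "simplicial_rational_cone {0..m} (all_but_cone m)"
proof -
  have "all_but m ` {1..m} \<subseteq> rational_vecs {0..m}"
    by (auto simp: rational_vecs_def all_but_in_vecs lookup_all_but)
  then show ?thesis
    using independent_all_but unfolding simplicial_rational_cone_def all_but_cone_def by blast
qed

text \<open>
  The last inequality is the one that matters: it expresses that \<open>\<lambda>\<^sub>j + \<lambda>\<^sub>k \<le> y\<^sub>0\<close> for the coefficients
  \<open>\<lambda>\<^sub>j = y\<^sub>0 - y\<^sub>j\<close>. All constraints are linear and homogeneous, so they define a convex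
  cone and it suffices to check them on the generators.
\<close>

lemma all_but_cone_inequalities:
  assumes "y \<in> all_but_cone m"
  shows "y \<in> vecs {0..m}"
    and "0 \<le> Poly_Mapping.lookup y j"
    and "Poly_Mapping.lookup y j \<le> Poly_Mapping.lookup y 0"
    and "\<lbrakk>j \<in> {1..m}; k \<in> {1..m}; j \<noteq> k\<rbrakk>
      \<Longrightarrow> Poly_Mapping.lookup y 0 \<le> Poly_Mapping.lookup y j + Poly_Mapping.lookup y k"
proof -
  define C where "C = {y :: nat rvec. (\<forall>j. j > m \<longrightarrow> Poly_Mapping.lookup y j = 0) \<and>
    (\<forall>j. 0 \<le> Poly_Mapping.lookup y j \<and> Poly_Mapping.lookup y j \<le> Poly_Mapping.lookup y 0) \<and>
    (\<forall>j\<in>{1..m}. \<forall>k\<in>{1..m}. j \<noteq> k \<longrightarrow>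
      Poly_Mapping.lookup y 0 \<le> Poly_Mapping.lookup y j + Poly_Mapping.lookup y k)}"
  have "all_but_cone m \<subseteq> C"
    unfolding all_but_cone_def
  proof (rule hull_minimal)
    show "all_but m ` {1..m} \<subseteq> C"
      by (auto simp: C_def lookup_all_but)
    have "x + y \<in> C" if "x \<in> C" "y \<in> C" for x y
    proof -
      have "Poly_Mapping.lookup x 0 + Poly_Mapping.lookup y 0
          \<le> Poly_Mapping.lookup x j + Poly_Mapping.lookup y j
            + (Poly_Mapping.lookup x k + Poly_Mapping.lookup y k)"
        if "j \<in> {1..m}" "k \<in> {1..m}" "j \<noteq> k" for j k
      proof -
        have "Poly_Mapping.lookup x 0 \<le> Poly_Mapping.lookup x j + Poly_Mapping.lookup x k"
          and "Poly_Mapping.lookup y 0 \<le> Poly_Mapping.lookup y j + Poly_Mapping.lookup y k"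
          using that \<open>x \<in> C\<close> \<open>y \<in> C\<close> unfolding C_def by blast+
        then show ?thesis by linarith
      qed
      then show ?thesis
        using that by (auto simp: C_def lookup_add add_mono)
    qed
    moreover have "r *\<^sub>R x \<in> C" if "x \<in> C" "0 \<le> r" for r x
      using that by (auto simp: C_def mult_left_mono simp flip: distrib_left)
    ultimately show "convex_cone C"
      by (auto simp: convex_cone_iff C_def)
  qed
  then have y: "y \<in> C" using assms by auto
  have "\<And>j. Poly_Mapping.lookup y j \<noteq> 0 \<Longrightarrow> j \<le> m"
    using y unfolding C_def by (metis (mono_tags, lifting) mem_Collect_eq not_le)
  then show "y \<in> vecs {0..m}"
    by (simp add: vecs_def subset_iff in_keys_iff)
  show "0 \<le> Poly_Mapping.lookup y j" "Poly_Mapping.lookup y j \<le> Poly_Mapping.lookup y 0"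
    using y by (auto simp: C_def)
  show "Poly_Mapping.lookup y 0 \<le> Poly_Mapping.lookup y j + Poly_Mapping.lookup y k"
    if "j \<in> {1..m}" "k \<in> {1..m}" "j \<noteq> k"
    using y that unfolding C_def by blast
qed

lemma linear_lookup: "linear (\<lambda>y :: 'e rvec. Poly_Mapping.lookup y e)"
  by (rule linearI) (simp_all add: lookup_add)

lemma all_but_cone_Int_unit_cube:
  "all_but_cone m \<inter> unit_cube {0..m} = convex hull (insert 0 (all_but m ` {1..m}))"
proof -
  have "all_but_cone m \<inter> unit_cube {0..m}
      = all_but_cone m \<inter> {y. Poly_Mapping.lookup y 0 \<le> 1}"
  proof -
    have "y \<in> unit_cube {0..m} \<longleftrightarrow> Poly_Mapping.lookup y 0 \<le> 1" if "y \<in> all_but_cone m" for y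
      using all_but_cone_inequalities(1-3)[OF that]
      by (auto simp: unit_cube_def intro: order.trans[where b = "Poly_Mapping.lookup y 0"])
    then show ?thesis by blast
  qed
  also have "\<dots> = convex hull (insert 0 (all_but m ` {1..m}))"
    unfolding all_but_cone_def
    by (rule truncated_convex_cone_hull[OF linear_lookup]) (auto simp: lookup_all_but)
  finally show ?thesis .
qed

section \<open>The blocking families\<close>

lemma dot_single: "finite E \<Longrightarrow> e \<in> E \<Longrightarrow> dot E (Poly_Mapping.single e 1) y = Poly_Mapping.lookup y e"
  by (simp add: dot_def lookup_single when_def if_distrib[of "\<lambda>x. x * _"] cong: if_cong)

lemma sum_le_pred_if_one_zero:
  fixes f :: "nat \<Rightarrow> real"
  assumes "i \<in> {1..l}" "f i \<le> 0" "\<And>i. i \<in> {1..l} \<Longrightarrow> f i \<le> 1"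
  shows "(\<Sum>i=1..l. f i) \<le> real l - 1"
proof -
  have "(\<Sum>i\<in>{1..l} - {i}. f i) \<le> real (card ({1..l} - {i})) * 1"
    using assms(3) by (intro sum_bounded_above) auto
  then show ?thesis
    using assms(1,2) sum.remove[OF _ assms(1), of f] by (simp add: of_nat_diff)
qed

text \<open>
  If \<open>l\<close> points jointly avoid a set \<open>J \<subseteq> {1..m}\<close> with more than \<open>l\<close> elements, one of them vanishes
  at two elements of \<open>J\<close>, and the pair inequality leaves it no objective. If \<open>J\<close> has at most \<open>l\<close> elements,
  the generators \<open>w\<^sub>j\<close> with \<open>j \<in> J\<close> jointly avoid it, and each has the full objective \<open>1\<close>.
\<close>

lemma blocking_eq:
  fixes P :: "nat rvec set"
  assumes m: "m \<ge> 1"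
    and le_1: "\<And>y. y \<in> P \<Longrightarrow> Poly_Mapping.lookup y 0 \<le> 1"
    and pair: "\<And>y j k. \<lbrakk>y \<in> P; j \<in> {1..m}; k \<in> {1..m}; j \<noteq> k\<rbrakk>
      \<Longrightarrow> Poly_Mapping.lookup y 0 \<le> Poly_Mapping.lookup y j + Poly_Mapping.lookup y k"
    and all_but: "\<And>i. i \<in> {1..m} \<Longrightarrow> all_but m i \<in> P"
  shows "blocking {0..m} P (Poly_Mapping.single 0 1) 1 l =
    {J. J \<subseteq> {0..m} \<and> 0 \<in> J} \<union> {J. J \<subseteq> {1..m} \<and> card J \<ge> l + 1}"
    (is "?B = ?A")
proof (rule set_eqI)
  fix J
  have bound: "(\<Sum>i=1..l. Poly_Mapping.lookup (z i) 0) \<le> real l - 1"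
    if z: "\<forall>i\<in>{1..l}. z i \<in> P" and disj: "(\<Inter>i\<in>{1..l}. supp {0..m} (z i)) \<inter> J = {}"
      and J: "J \<in> ?A" for z
  proof -
    have ex: "\<forall>j\<in>J. \<exists>i. i \<in> {1..l} \<and> Poly_Mapping.lookup (z i) j \<le> 0"
    proof
      fix j assume "j \<in> J"
      moreover have "j \<le> m" using J \<open>j \<in> J\<close> by auto
      ultimately show "\<exists>i. i \<in> {1..l} \<and> Poly_Mapping.lookup (z i) j \<le> 0"
        using disj by (force simp: supp_def not_less)
    qed
    have "\<exists>i\<in>{1..l}. Poly_Mapping.lookup (z i) 0 \<le> 0"
    proof (cases "0 \<in> J")
      case True
      then show ?thesis using ex by blast
    next
      case False
      then have J1: "J \<subseteq> {1..m}" and card: "card J \<ge> l + 1" using J by auto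
      obtain h where h: "\<And>j. j \<in> J \<Longrightarrow> h j \<in> {1..l} \<and> Poly_Mapping.lookup (z (h j)) j \<le> 0"
        using bchoice[OF ex] by auto
      have "card (h ` J) \<le> card {1..l}"
        using h by (intro card_mono) auto
      then have "\<not> inj_on h J"
        using card by (intro pigeonhole) simp
      then obtain j k where jk: "j \<in> J" "k \<in> J" "j \<noteq> k" "h j = h k"
        by (auto simp: inj_on_def)
      have "Poly_Mapping.lookup (z (h j)) 0
          \<le> Poly_Mapping.lookup (z (h j)) j + Poly_Mapping.lookup (z (h j)) k"
        using jk J1 z h by (intro pair) auto
      also have "\<dots> \<le> 0"
        using h[OF jk(1)] h[OF jk(2)] jk(4) by simp
      finally show ?thesis using h[OF jk(1)] by auto
    qed
    then obtain i where i: "i \<in> {1..l}" "Poly_Mapping.lookup (z i) 0 \<le> 0" by blast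
    then show ?thesis
      using z le_1 by (intro sum_le_pred_if_one_zero[of i]) auto
  qed
  have witness: "\<exists>z. (\<forall>i\<in>{1..l}. z i \<in> P) \<and> (\<Inter>i\<in>{1..l}. supp {0..m} (z i)) \<inter> J = {} \<and>
      (\<Sum>i=1..l. Poly_Mapping.lookup (z i) 0) > real l - 1"
    if J: "J \<subseteq> {0..m}" "J \<notin> ?A"
  proof -
    have J1: "J \<subseteq> {1..m}"
    proof
      fix j assume "j \<in> J"
      moreover have "0 \<notin> J" using J by auto
      ultimately have "j \<noteq> 0" by metis
      moreover have "j \<le> m" using J \<open>j \<in> J\<close> by auto
      ultimately show "j \<in> {1..m}" by auto
    qed
    then have "card J \<le> card {1..l}" using J by auto
    moreover have "finite J" using J1 finite_subset by blast
    ultimately obtain g where g: "g ` J \<subseteq> {1..l}" "inj_on g J"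
      using card_le_inj[of J "{1..l}"] by auto
    \<comment> \<open>The index \<open>i = g j\<close> takes care of \<open>j\<close>; the other indices may use any generator, here \<open>w\<^sub>1\<close>.\<close>
    define h where "h i = (if i \<in> g ` J then inv_into J g i else 1)" for i
    have h_in: "h i \<in> {1..m}" for i
      using J1 m inv_into_into[of i g J] by (auto simp: h_def)
    have "(\<Inter>i\<in>{1..l}. supp {0..m} (all_but m (h i))) \<inter> J = {}"
    proof -
      have "j \<notin> supp {0..m} (all_but m (h (g j)))" if "j \<in> J" for j
        using that g by (simp add: h_def supp_def lookup_all_but)
      then show ?thesis using g(1) by blast
    qed
    moreover have "Poly_Mapping.lookup (all_but m (h i)) 0 = 1" for i
      using h_in[of i] by (auto simp: lookup_all_but)
    ultimately show ?thesis
      using all_but h_in by (intro exI[of _ "\<lambda>i. all_but m (h i)"]) auto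
  qed
  have dot_0: "dot {0..m} (Poly_Mapping.single 0 1) y = Poly_Mapping.lookup y 0" for y
    by (rule dot_single) auto
  have B_iff: "J \<in> ?B \<longleftrightarrow> J \<subseteq> {0..m} \<and> (\<forall>z. (\<forall>i\<in>{1..l}. z i \<in> P) \<longrightarrow>
      (\<Inter>i\<in>{1..l}. supp {0..m} (z i)) \<inter> J = {} \<longrightarrow>
      (\<Sum>i=1..l. Poly_Mapping.lookup (z i) 0) \<le> real l - 1)"
    \<comment> \<open>The simplifier would identify \<open>single 0 1\<close> with the unit of the ring of polynomial mappings.\<close>
    unfolding blocking_def by (simp add: dot_0 del: single_one)
  show "J \<in> ?B \<longleftrightarrow> J \<in> ?A"
  proof
    assume "J \<in> ?B"
    then show "J \<in> ?A" using witness unfolding B_iff by (meson not_less)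
  next
    assume J: "J \<in> ?A"
    then have "J \<subseteq> {0..m}" by auto
    then show "J \<in> ?B" using bound J unfolding B_iff by blast
  qed
qed

text \<open>
  The set \<open>{1..l+1}\<close> separates level \<open>l\<close> from level \<open>l + 1\<close>. It fits into \<open>{1..m}\<close> exactly when
  \<open>l < m\<close>, so the chain is strict up to \<open>m\<close>; from then on only the sets containing \<open>0\<close> are left.
\<close>

lemma stabilization_level:
  fixes B :: "nat \<Rightarrow> nat set set"
  assumes m: "m \<ge> 1"
    and B: "\<And>l. l \<ge> 1 \<Longrightarrow>
      B l = {J. J \<subseteq> {0..m} \<and> 0 \<in> J} \<union> {J. J \<subseteq> {1..m} \<and> card J \<ge> l + 1}"
  shows "\<lbrakk>1 \<le> l; l < m\<rbrakk> \<Longrightarrow> B (l + 1) \<subset> B l"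
    and "(\<Inter>l\<in>{1..}. B l) = B m"
    and "\<lbrakk>l \<ge> 1; B l = B m\<rbrakk> \<Longrightarrow> m \<le> l"
proof -
  have mem: "{1..l+1} \<in> B k \<longleftrightarrow> k \<le> l" if "1 \<le> k" "l < m" for k l
    using that by (auto simp: B)
  show "B (l + 1) \<subset> B l" if "1 \<le> l" "l < m"
  proof
    show "B (l + 1) \<subseteq> B l" using that by (auto simp: B)
    show "B (l + 1) \<noteq> B l" using mem[of l l] mem[of "l + 1" l] that by auto
  qed
  have Bm: "B m = {J. J \<subseteq> {0..m} \<and> 0 \<in> J}"
  proof -
    have "\<not> card J \<ge> m + 1" if "J \<subseteq> {1..m}" for J
      using card_mono[OF _ that] by simp
    then show ?thesis unfolding B[OF m] by blast
  qed
  have "B m \<subseteq> B l" if "l \<ge> 1" for l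
    unfolding Bm using B[OF that] by blast
  then show "(\<Inter>l\<in>{1..}. B l) = B m" using m by (intro antisym INF_lower INF_greatest) auto
  show "m \<le> l" if "l \<ge> 1" "B l = B m"
    using mem[of l l] mem[of m l] that m by force
qed

theorem corollary3p6:
  fixes m :: nat and E :: "nat set"
  assumes "m \<ge> 2" and "E = {0..m}"
  shows "\<exists>(K :: nat rvec set) P c \<alpha>.
    simplicial_rational_cone E K \<and> K \<subseteq> nonneg_orthant E \<and>
    P = K \<inter> unit_cube E \<and> is_simplex P \<and>
    (\<exists>e\<in>E. c = Poly_Mapping.single e 1) \<and>
    is_max_on (dot E c) P \<alpha> \<and> \<alpha> > 0 \<and>
    (\<forall>l\<ge>1. blocking E P c \<alpha> l =
       {J. J \<subseteq> E \<and> 0 \<in> J} \<union> {J. J \<subseteq> {1..m} \<and> card J \<ge> l + 1}) \<and>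
    (\<forall>l. 1 \<le> l \<and> l < m \<longrightarrow> blocking E P c \<alpha> (l + 1) \<subset> blocking E P c \<alpha> l) \<and>
    blocking E P c \<alpha> m = blocking_inf E P c \<alpha> \<and>
    card E - 1 = m \<and>
    (\<forall>l\<ge>1. blocking E P c \<alpha> l = blocking_inf E P c \<alpha> \<longrightarrow> card E - 1 \<le> l)"
proof -
  define P where "P = all_but_cone m \<inter> unit_cube E"
  define c :: "nat rvec" where "c = Poly_Mapping.single 0 1"
  have m: "m \<ge> 1" using assms by simp
  have P_hull: "P = convex hull (insert 0 (all_but m ` {1..m}))"
    using all_but_cone_Int_unit_cube by (simp add: P_def assms(2))
  have le_1: "Poly_Mapping.lookup y 0 \<le> 1" if "y \<in> P" for y
    using that by (auto simp: P_def unit_cube_def assms(2))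
  have all_but_P: "all_but m i \<in> P" if "i \<in> {1..m}" for i
    using that by (simp add: P_hull hull_inc)
  have block: "blocking E P c 1 l =
      {J. J \<subseteq> {0..m} \<and> 0 \<in> J} \<union> {J. J \<subseteq> {1..m} \<and> card J \<ge> l + 1}" if "l \<ge> 1" for l
    unfolding c_def assms(2)
  proof (rule blocking_eq[OF m le_1])
    show "Poly_Mapping.lookup y 0 \<le> Poly_Mapping.lookup y j + Poly_Mapping.lookup y k"
      if "y \<in> P" "j \<in> {1..m}" "k \<in> {1..m}" "j \<noteq> k" for y j k
      using that all_but_cone_inequalities(4)[of y m j k] by (simp add: P_def)
  qed (use all_but_P in auto)
  note levels = stabilization_level[OF m block]
  have inf: "blocking_inf E P c 1 = blocking E P c 1 m"
    using levels(2) by (simp add: blocking_inf_def)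
  have dot: "dot E c y = Poly_Mapping.lookup y 0" for y
    unfolding c_def assms(2) by (rule dot_single) auto
  have "is_max_on (dot E c) P 1"
  proof -
    have "dot E c (all_but m 1) = 1" by (simp add: dot lookup_all_but)
    moreover have "all_but m 1 \<in> P" using m by (intro all_but_P) simp
    ultimately have "1 \<in> dot E c ` P" by force
    then show ?thesis using le_1 by (auto simp: is_max_on_def dot)
  qed
  moreover have "is_simplex P"
    unfolding P_hull
    by (intro is_simplex_convex_hull affine_independent_insert_0 independent_all_but) simp
  moreover have "all_but_cone m \<subseteq> nonneg_orthant E"
    using all_but_cone_inequalities(1,2) by (auto simp: nonneg_orthant_def assms(2))
  moreover have "simplicial_rational_cone E (all_but_cone m)"
    using simplicial_all_but_cone by (simp add: assms(2))
  moreover have "\<exists>e\<in>E. c = Poly_Mapping.single e 1"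
    unfolding c_def assms(2) by (rule bexI[of _ 0]) auto
  moreover have "card E - 1 = m" by (simp add: assms(2))
  moreover have "\<forall>l\<ge>1. blocking E P c 1 l =
      {J. J \<subseteq> E \<and> 0 \<in> J} \<union> {J. J \<subseteq> {1..m} \<and> card J \<ge> l + 1}"
    using block by (simp add: assms(2))
  moreover have "\<forall>l. 1 \<le> l \<and> l < m \<longrightarrow> blocking E P c 1 (l + 1) \<subset> blocking E P c 1 l"
    using levels(1) by blast
  moreover have "\<forall>l\<ge>1. blocking E P c 1 l = blocking_inf E P c 1 \<longrightarrow> m \<le> l"
    using levels(3) by (simp add: inf)
  ultimately show ?thesis
    using inf P_def
    by (intro exI[of _ "all_but_cone m"] exI[of _ P] exI[of _ c] exI[of _ 1]) simp
qed

end
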